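(* The map $f$ is a bijection from the set $\mathcal{C}$ of all coin fountains to the set $\mathcal{S}$ of all Stanley polyominoes with at least two columns such that, for every coin fountain $C$ with $n$ north-east diagonals, $f(C)$ has $n+1$ columns and \[ 2e(C)-o(C)=\mathrm{area}(f(C)). \]
   Context: Stanley polyominoes: cells are unit squares $[i,i+1]\times[j,j+1]$; a Stanley polyomino (up to translation) is a set of cells forming $k\ge1$ rows $0,\dots,k-1$ (bottom to top), row $j$ consisting of the cells with $s_j\le i\le e_j$, such that $s_{j-1}<s_j\le e_{j-1}<e_j$ for $1\le j\le k-1$; its number of columns is $e_{k-1}-s_0+1$ and $\mathrm{area}$ is its number of cells. Coin fountains: a coin fountain with $d\geq1$ diagonals is a finite set $C\subset\mathbb{Z}\times\mathbb{Z}_{\ge0}$ (positions of coins) whose row $0$ is $\{(2i,0):0\le i\le d-1\}$ and such that every $(a,j)\in C$ with $j\geq1$ has $(a-1,j-1),(a+1,j-1)\in C$. The $i$-th north-east diagonal consists of the coins $(2i+j,j)\in C$; $\mathrm{diag}(C)$ is the number of coins on the first diagonal $i=0$. If $d\ge2$, $C'=\{(a-2,j):(a,j)\in C,\ a-j\ge2\}$ is the coin fountain obtained by deleting the first diagonal. Rows are numbered $0,1,2,\dots$ from the bottom; $e(C)$ (resp. $o(C)$) is the number of coins in even-numbered (resp. odd-numbered) rows. The map $f$: if $C$ is a single coin, $f(C)$ is the single row of two cells. If $d\ge2$, let $k=\mathrm{diag}(C)$ and $P'=f(C')$ with rows given by $s_j,e_j$. If $k=2\ell+1$ ($\ell\ge0$),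 $f(C)$ is obtained by adding below $P'$ a new bottom row of $\ell+2$ cells occupying $s_0-1\le i\le s_0+\ell$ (old rows move up by one). If $k=2\ell$ ($\ell\ge1$), $f(C)$ is obtained from $P'$ by adding one cell at the left end of each of its $\ell$ lowest rows (replacing $s_j$ by $s_j-1$ for $0\le j\le\ell-1$). This construction is always well defined and produces a Stanley polyomino. *)

theory Defs
  imports Main
begin

subsection \<open>Stanley polyominoes\<close>

text \<open>
  The cell \<open>[i,i+1] \<times> [j,j+1]\<close> is represented by its lower left corner \<open>(i,j)\<close>.  A list \<open>R\<close> of
  pairs describes the polyomino whose \<open>j\<close>-th row from the bottom has \<open>R ! j = (s\<^sub>j, e\<^sub>j)\<close>.
\<close>

type_synonym cell = "int \<times> int"
type_synonym rows = "(int \<times> int) list"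

definition cells :: "rows \<Rightarrow> cell set" where
  "cells R = {(i, int j) | i j. j < length R \<and> fst (R ! j) \<le> i \<and> i \<le> snd (R ! j)}"

text \<open>
  The condition \<open>s\<^sub>j \<le> e\<^sub>j\<close> (rows are nonempty) follows from the chain of inequalities
  unless there is only one row.
\<close>

definition stanley_rows :: "rows \<Rightarrow> bool" where
  "stanley_rows R \<longleftrightarrow>
     length R \<ge> 1 \<and>
     (\<forall>j < length R. fst (R ! j) \<le> snd (R ! j)) \<and>
     (\<forall>j. 1 \<le> j \<and> j \<le> length R - 1 \<longrightarrow>
        fst (R ! (j - 1)) < fst (R ! j) \<and>
        fst (R ! j) \<le> snd (R ! (j - 1)) \<and>
        snd (R ! (j - 1)) < snd (R ! j))"

definition translate :: "int \<times> int \<Rightarrow> cell set \<Rightarrow> cell set" where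
  "translate v X = (\<lambda>(i, j). (i + fst v, j + snd v)) ` X"

definition translation_class :: "cell set \<Rightarrow> cell set set" where
  "translation_class X = {translate v X | v. True}"

definition stanley_polyominoes :: "cell set set set" where
  "stanley_polyominoes = {translation_class (cells R) | R. stanley_rows R}"

text \<open>
  Any representative may be used to compute the number of columns and the area;
  see the lemmas \<open>num_columns_eq\<close> and \<open>area_eq\<close> below.
\<close>

definition rows_of :: "cell set set \<Rightarrow> rows" where
  "rows_of P = (SOME R. stanley_rows R \<and> P = translation_class (cells R))"

definition num_columns :: "cell set set \<Rightarrow> int" where
  "num_columns P = snd (last (rows_of P)) - fst (hd (rows_of P)) + 1"

definition area :: "cell set set \<Rightarrow> nat" where
  "area P = card (cells (rows_of P))"

lemma translation_class_cells_eqD: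
  assumes R: "stanley_rows R" and R': "stanley_rows R'"
    and eq: "translation_class (cells R) = translation_class (cells R')"
  shows "\<exists>u. R' = map (\<lambda>(s, e). (s + u, e + u)) R \<and> cells R' = translate (u, 0) (cells R)"
proof -
  have "cells R' = translate (0, 0) (cells R')"
    by (auto simp: translate_def)
  then have "cells R' \<in> translation_class (cells R')"
    unfolding translation_class_def by blast
  then have "cells R' \<in> translation_class (cells R)"
    unfolding eq .
  then obtain u v where uv: "cells R' = translate (u, v) (cells R)"
    by (auto simp: translation_class_def)
  have mem: "(i, j) \<in> cells R' \<longleftrightarrow> (i - u, j - v) \<in> cells R" for i j
    unfolding uv translate_def by force
  have row: "(i, j) \<in> cells T \<longleftrightarrow>
      0 \<le> j \<and> nat j < length T \<and> fst (T ! nat j) \<le> i \<and> i \<le> snd (T ! nat j)" for i j T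
    by (auto simp: cells_def) (metis int_nat_eq)
  have ex: "(\<exists>i. (i, j) \<in> cells T) \<longleftrightarrow> 0 \<le> j \<and> j < int (length T)" if "stanley_rows T" for j T
    using that unfolding row stanley_rows_def by (auto simp: nat_less_iff)
  have hts: "(0 \<le> j \<and> j < int (length R')) \<longleftrightarrow> (0 \<le> j - v \<and> j - v < int (length R))" for j
    unfolding ex[OF R, symmetric] ex[OF R', symmetric] mem
    by (metis add_diff_cancel_right')
  have pos: "length R > 0" "length R' > 0"
    using R R' by (auto simp: stanley_rows_def)
  have "v \<ge> 0"
    using hts[of v] pos by auto
  moreover have "v \<le> 0"
    using hts[of 0] pos by auto
  ultimately have v0: "v = 0" by simp
  have len: "length R' = length R"
    using hts[of "int (length R)"] hts[of "int (length R')"] v0 by auto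
  have "R' ! j = (fst (R ! j) + u, snd (R ! j) + u)" if j: "j < length R" for j
  proof -
    have ne: "fst (R ! j) \<le> snd (R ! j)" "fst (R' ! j) \<le> snd (R' ! j)"
      using R R' j len by (auto simp: stanley_rows_def)
    have *: "(fst (R' ! j) \<le> i \<and> i \<le> snd (R' ! j)) \<longleftrightarrow>
        (fst (R ! j) \<le> i - u \<and> i - u \<le> snd (R ! j))" for i
      using mem[of i "int j"] j len v0 by (simp add: row)
    have "fst (R' ! j) \<ge> fst (R ! j) + u" "snd (R' ! j) \<le> snd (R ! j) + u"
      using *[of "fst (R' ! j)"] *[of "snd (R' ! j)"] ne by auto
    moreover have "fst (R' ! j) \<le> fst (R ! j) + u" "snd (R' ! j) \<ge> snd (R ! j) + u"
      using *[of "fst (R ! j) + u"] *[of "snd (R ! j) + u"] ne by auto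
    ultimately have "fst (R' ! j) = fst (R ! j) + u" "snd (R' ! j) = snd (R ! j) + u"
      by simp_all
    then show ?thesis
      by (metis prod.collapse)
  qed
  then have "R' = map (\<lambda>(s, e). (s + u, e + u)) R"
    using len by (intro nth_equalityI) (auto simp: case_prod_beta)
  with uv v0 show ?thesis by blast
qed

lemma rows_of_translation_class:
  assumes "stanley_rows R"
  shows "\<exists>u. rows_of (translation_class (cells R)) = map (\<lambda>(s, e). (s + u, e + u)) R \<and>
             cells (rows_of (translation_class (cells R))) = translate (u, 0) (cells R)"
proof -
  let ?Q = "\<lambda>T. stanley_rows T \<and> translation_class (cells R) = translation_class (cells T)"
  have "?Q (SOME T. ?Q T)"
    using assms by (intro someI[of ?Q R]) simp
  then show ?thesis
    unfolding rows_of_def using translation_class_cells_eqD[OF assms] by blast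
qed

lemma num_columns_eq:
  assumes "stanley_rows R"
  shows "num_columns (translation_class (cells R)) = snd (last R) - fst (hd R) + 1"
proof -
  have "R \<noteq> []" using assms by (auto simp: stanley_rows_def)
  then show ?thesis
    using rows_of_translation_class[OF assms]
    by (auto simp: num_columns_def last_map hd_map case_prod_beta)
qed

lemma area_eq:
  assumes "stanley_rows R"
  shows "area (translation_class (cells R)) = card (cells R)"
proof -
  have "card (translate (u, 0) (cells R)) = card (cells R)" for u
    unfolding translate_def by (rule card_image) (auto simp: inj_on_def)
  then show ?thesis
    using rows_of_translation_class[OF assms] by (auto simp: area_def)
qed

subsection \<open>Coin fountains\<close>

type_synonym coins = "(int \<times> nat) set"

definition coin_fountain :: "nat \<Rightarrow> coins \<Rightarrow> bool" where
  "coin_fountain d C \<longleftrightarrow>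
     d \<ge> 1 \<and> finite C \<and>
     {c \<in> C. snd c = 0} = {(2 * int i, 0) | i. i \<le> d - 1} \<and>
     (\<forall>a j. (a, j) \<in> C \<and> j \<ge> 1 \<longrightarrow> (a - 1, j - 1) \<in> C \<and> (a + 1, j - 1) \<in> C)"

definition coin_fountains :: "coins set" where
  "coin_fountains = {C. \<exists>d. coin_fountain d C}"

definition diag :: "coins \<Rightarrow> nat" where
  "diag C = card {c \<in> C. fst c = int (snd c)}"

definition delete_diag :: "coins \<Rightarrow> coins" where
  "delete_diag C = {(a - 2, j) | a j. (a, j) \<in> C \<and> a - int j \<ge> 2}"

definition even_coins :: "coins \<Rightarrow> nat" where
  "even_coins C = card {c \<in> C. even (snd c)}"

definition odd_coins :: "coins \<Rightarrow> nat" where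
  "odd_coins C = card {c \<in> C. odd (snd c)}"

definition num_diagonals :: "coins \<Rightarrow> nat" where
  "num_diagonals C = card {c \<in> C. snd c = 0}"

lemma num_diagonals_eq:
  assumes "coin_fountain d C"
  shows "num_diagonals C = d"
proof -
  have "{c \<in> C. snd c = 0} = (\<lambda>i. (2 * int i, 0)) ` {..d - 1}"
    using assms by (auto simp: coin_fountain_def)
  moreover have "card ((\<lambda>i. (2 * int i, 0 :: nat)) ` {..d - 1}) = d"
    using assms by (subst card_image) (auto simp: inj_on_def coin_fountain_def)
  ultimately show ?thesis
    by (simp add: num_diagonals_def)
qed

subsection \<open>The map\<close>

definition add_bottom_row :: "nat \<Rightarrow> rows \<Rightarrow> rows" where
  "add_bottom_row l R = (fst (R ! 0) - 1, fst (R ! 0) + int l) # R"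

text \<open>
  \<open>take\<close> would truncate if \<open>R\<close> had fewer than \<open>l\<close> rows; this never happens in the recursion
  below when it is started from a coin fountain.
\<close>

definition extend_left :: "nat \<Rightarrow> rows \<Rightarrow> rows" where
  "extend_left l R = map (\<lambda>(s, e). (s - 1, e)) (take l R) @ drop l R"

text \<open>
  The recursion is on the number \<open>d\<close> of diagonals; a fountain has a single coin iff \<open>d = 1\<close>.
  The value at \<open>d = 0\<close> is arbitrary.
\<close>

fun fountain_rows :: "nat \<Rightarrow> coins \<Rightarrow> rows" where
  "fountain_rows 0 C = []"
| "fountain_rows (Suc 0) C = [(0, 1)]"
| "fountain_rows (Suc (Suc d)) C =
     (let k = diag C; R = fountain_rows (Suc d) (delete_diag C)
      in if odd k then add_bottom_row ((k - 1) div 2) R else extend_left (k div 2) R)"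

definition fountain_polyomino :: "coins \<Rightarrow> cell set set" where
  "fountain_polyomino C = translation_class (cells (fountain_rows (num_diagonals C) C))"

end

theory Submission
  imports Defs
begin

text \<open>
  Call a run of a Stanley polyomino the maximal \<open>m\<close> such that \<open>s\<^sub>j = s\<^sub>0 + j\<close> for \<open>j < m\<close>, and let
  its bottom row have \<open>w + 2\<close> cells.  The number of coins on the first diagonal of the
  fountain can be read off as \<open>min (2 m) (2 w + 1)\<close>: adding a bottom row of \<open>l + 2\<close> cells yields \<open>w = l < m\<close>,
  while extending the \<open>l\<close> lowest rows opens a gap after row \<open>l - 1\<close>, so that \<open>m = l \<le> w\<close>.
  Since the next diagonal of a fountain may have any positive number of coins exceeding the current
  one by at most 1, and these are exactly the values for which the step can be undone, \<open>f\<close> is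
  inverted one column at a time.  Fixing the right end of the top row at 1 removes the translations.
\<close>

section \<open>Rows of a Stanley polyomino\<close>

lemma stanley_rows_Nil [simp]: "\<not> stanley_rows []"
  by (simp add: stanley_rows_def)

lemma stanley_rows_single [simp]: "stanley_rows [x] \<longleftrightarrow> fst x \<le> snd x"
  by (auto simp: stanley_rows_def)

text \<open>The indexed condition becomes a recursion along the list, suited to induction on rows.
  Nonemptiness of row \<open>x\<close> is absent on the right because it follows from
  \<open>fst x < fst y\<close> and \<open>fst y \<le> snd x\<close>.\<close>

lemma stanley_rows_Cons2 [simp]:
  "stanley_rows (x # y # R) \<longleftrightarrow>
     fst x < fst y \<and> fst y \<le> snd x \<and> snd x < snd y \<and> stanley_rows (y # R)"
proof -
  have shift: "(\<forall>j. 1 \<le> j \<and> j \<le> n \<longrightarrow> P (j - 1) j) \<longleftrightarrow> (\<forall>j<n. P j (Suc j))"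
    for P :: "nat \<Rightarrow> nat \<Rightarrow> bool" and n
  proof safe
    fix j assume "\<forall>j. 1 \<le> j \<and> j \<le> n \<longrightarrow> P (j - 1) j" "j < n"
    then show "P j (Suc j)" by (auto dest: spec[of _ "Suc j"])
  next
    fix j assume "\<forall>j<n. P j (Suc j)" "1 \<le> j" "j \<le> n"
    then show "P (j - 1) j" by (cases j) auto
  qed
  have "stanley_rows T \<longleftrightarrow> length T \<ge> 1 \<and> (\<forall>j<length T. fst (T ! j) \<le> snd (T ! j)) \<and>
      (\<forall>j<length T - 1. fst (T ! j) < fst (T ! Suc j) \<and> fst (T ! Suc j) \<le> snd (T ! j) \<and>
        snd (T ! j) < snd (T ! Suc j))" for T
    unfolding stanley_rows_def
    shift[of "length T - 1" "\<lambda>i j. fst (T ! i) < fst (T ! j) \<and> fst (T ! j) \<le> snd (T ! i) \<and>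
        snd (T ! i) < snd (T ! j)"] ..
  then show ?thesis by (auto simp: All_less_Suc2)
qed

text \<open>Every further row moves the right end by at least one column. This bounds the number of
  rows in the two-column base case of surjectivity.\<close>

lemma stanley_rows_columns: "stanley_rows R \<Longrightarrow> fst (hd R) + int (length R) \<le> snd (last R) + 1"
proof (induction R rule: induct_list012)
  case (3 x y R)
  then show ?case by (auto split: if_splits)
qed auto

lemma card_cells: "card (cells R) = sum_list (map (\<lambda>(s, e). nat (e - s + 1)) R)"
proof -
  have "cells R = (\<lambda>(j, i). (i, int j)) ` Sigma {..<length R} (\<lambda>j. {fst (R ! j)..snd (R ! j)})"
    by (force simp: cells_def)
  then have "card (cells R) = card (Sigma {..<length R} (\<lambda>j. {fst (R ! j)..snd (R ! j)}))"
    by (simp add: card_image inj_on_def)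
  also have "\<dots> = (\<Sum>j<length R. nat (snd (R ! j) - fst (R ! j) + 1))"
    by (simp add: algebra_simps)
  also have "\<dots> = sum_list (map (\<lambda>(s, e). nat (e - s + 1)) R)"
    by (simp add: sum_list_sum_nth atLeast0LessThan case_prod_beta)
  finally show ?thesis .
qed

section \<open>Extending and shortening rows\<close>

lemma extend_left_0 [simp]: "extend_left 0 R = R"
  by (simp add: extend_left_def)

lemma extend_left_Suc [simp]:
  "extend_left (Suc l) (x # R) = (fst x - 1, snd x) # extend_left l R"
  by (simp add: extend_left_def case_prod_beta)

text \<open>The two-sided inverse of \<open>extend_left l\<close>.\<close>

definition shorten_left :: "nat \<Rightarrow> rows \<Rightarrow> rows" where
  "shorten_left l R = map (\<lambda>(s, e). (s + 1, e)) (take l R) @ drop l R"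

lemma extend_left_Nil [simp]: "extend_left l [] = []"
  by (simp add: extend_left_def)

lemma shorten_left_Nil [simp]: "shorten_left l [] = []"
  by (simp add: shorten_left_def)

lemma shorten_left_0 [simp]: "shorten_left 0 R = R"
  by (simp add: shorten_left_def)

lemma shorten_left_Suc [simp]:
  "shorten_left (Suc l) (x # R) = (fst x + 1, snd x) # shorten_left l R"
  by (simp add: shorten_left_def case_prod_beta)

lemma length_shorten_left [simp]: "length (shorten_left l R) = length R"
  by (simp add: shorten_left_def)

lemma shorten_extend [simp]: "shorten_left l (extend_left l R) = R"
proof (induction l arbitrary: R)
  case (Suc l)
  then show ?case by (cases R) simp_all
qed simp

lemma extend_shorten [simp]: "extend_left l (shorten_left l R) = R"
proof (induction l arbitrary: R)
  case (Suc l)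
  then show ?case by (cases R) simp_all
qed simp

lemma snd_last_extend_left [simp]: "snd (last (extend_left l R)) = snd (last R)"
proof (induction R arbitrary: l)
  case (Cons x R)
  show ?case
  proof (cases l)
    case (Suc l')
    have "extend_left l' R = [] \<longleftrightarrow> R = []" by (auto simp: extend_left_def)
    with Suc Cons show ?thesis by auto
  qed simp
qed (simp add: extend_left_def)

lemma fst_hd_extend_left:
  "R \<noteq> [] \<Longrightarrow> l \<ge> 1 \<Longrightarrow> fst (hd (extend_left l R)) = fst (hd R) - 1"
  by (cases R; cases l) auto

lemma snd_hd_extend_left [simp]: "R \<noteq> [] \<Longrightarrow> snd (hd (extend_left l R)) = snd (hd R)"
  by (cases R; cases l) auto

lemma extend_left_eq_Nil [simp]: "extend_left l R = [] \<longleftrightarrow> R = []"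
  by (auto simp: extend_left_def)

text \<open>Inside the extended block the left ends keep their differences, at its top the gap only
  grows, and the overlap of consecutive rows never shrinks.\<close>

lemma stanley_rows_extend_left: "stanley_rows R \<Longrightarrow> stanley_rows (extend_left l R)"
proof (induction R arbitrary: l rule: induct_list012)
  case (2 x)
  then show ?case by (cases l) auto
next
  case (3 x y R)
  show ?case
  proof (cases l)
    case (Suc l')
    show ?thesis
      using "3.IH"(2)[of l'] "3.prems" Suc by (cases l') auto
  qed (use 3 in simp)
qed simp

lemma card_cells_extend_left:
  "stanley_rows R \<Longrightarrow> l \<le> length R \<Longrightarrow> card (cells (extend_left l R)) = card (cells R) + l"
proof (induction R arbitrary: l rule: induct_list012)
  case (2 x)
  then show ?case by (cases l) (auto simp: card_cells case_prod_beta)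
next
  case (3 x y R)
  show ?case
  proof (cases l)
    case (Suc l')
    show ?thesis
      using "3.IH"(2)[of l'] "3.prems" Suc by (auto simp: card_cells case_prod_beta)
  qed simp
qed simp

section \<open>Reading off the last step\<close>

fun run :: "rows \<Rightarrow> nat" where
  "run [] = 0"
| "run [x] = 1"
| "run (x # y # R) = (if fst y = fst x + 1 then Suc (run (y # R)) else 1)"

lemma run_pos: "R \<noteq> [] \<Longrightarrow> run R \<ge> 1"
  by (induction R rule: run.induct) auto

lemma run_le_length: "run R \<le> length R"
  by (induction R rule: run.induct) auto

text \<open>One argument of \<open>min\<close> is even and the other odd, so the parity of the value
  tells which kind of step came last.\<close>

definition last_step :: "rows \<Rightarrow> nat" where
  "last_step R = min (2 * run R) (2 * nat (snd (hd R) - fst (hd R) - 1) + 1)"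

definition step :: "nat \<Rightarrow> rows \<Rightarrow> rows" where
  "step k R = (if odd k then add_bottom_row ((k - 1) div 2) R else extend_left (k div 2) R)"

text \<open>At least two columns, as in every value of the map.\<close>

definition wide_rows :: "rows \<Rightarrow> bool" where
  "wide_rows R \<longleftrightarrow> stanley_rows R \<and> fst (hd R) < snd (last R)"

lemma wide_rows_hd: "wide_rows R \<Longrightarrow> fst (hd R) < snd (hd R)"
  unfolding wide_rows_def by (cases R rule: run.cases) auto

text \<open>The left ends of the lowest \<open>l\<close> rows still increase by one, but row
  \<open>l\<close>, if present, stays put and now lies at least two columns to the right of row
  \<open>l - 1\<close>.\<close>

lemma run_extend_left:
  "stanley_rows R \<Longrightarrow> 1 \<le> l \<Longrightarrow> l \<le> run R \<Longrightarrow> run (extend_left l R) = l"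
proof (induction R arbitrary: l rule: run.induct)
  case (3 x y R)
  show ?case
  proof (cases "l = 1")
    case True
    then show ?thesis using "3.prems" by auto
  next
    case False
    then obtain l' where l': "l = Suc (Suc l')"
      using "3.prems" by (metis One_nat_def Suc_le_D not0_implies_Suc)
    then show ?thesis
      using "3.IH"[of "Suc l'"] "3.prems" by (auto split: if_splits)
  qed
qed (auto simp: extend_left_def)

text \<open>The bound on \<open>k\<close> is what keeps a step legal and readable from its result.
  The last equation adds \<open>(k + 1) div 2\<close> coins in even rows and \<open>k div 2\<close>
  in odd rows, stated without subtraction.\<close>

lemma wide_rows_step:
  assumes R: "wide_rows R" and k: "1 \<le> k" "k \<le> last_step R + 1"
  shows "wide_rows (step k R)" and "last_step (step k R) = k"
    and "snd (last (step k R)) = snd (last R)"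
    and "fst (hd (step k R)) = fst (hd R) - 1"
    and "card (cells (step k R)) + k div 2 = card (cells R) + 2 * ((k + 1) div 2)"
proof -
  have st: "stanley_rows R" and ne: "R \<noteq> []" and hd: "fst (hd R) < snd (hd R)"
    using R wide_rows_hd[OF R] by (auto simp: wide_rows_def)
  have "wide_rows (step k R) \<and> last_step (step k R) = k \<and> snd (last (step k R)) = snd (last R) \<and>
    fst (hd (step k R)) = fst (hd R) - 1 \<and>
    card (cells (step k R)) + k div 2 = card (cells R) + 2 * ((k + 1) div 2)"
  proof (cases "odd k")
    case True
    then obtain l where l: "k = 2 * l + 1" by (auto elim: oddE)
    obtain x T where xT: "R = x # T" using ne by (cases R) auto
    \<comment> \<open>The second bound makes the new row end strictly before the old bottom row; the
      first makes \<open>2 * l + 1\<close> the minimum, as the run grows to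
      \<open>run R + 1\<close>.\<close>
    have "l \<le> run R" "int l \<le> snd (hd R) - fst (hd R) - 1"
      using k l hd by (auto simp: last_step_def)
    then show ?thesis
      using R l xT by (auto simp: step_def add_bottom_row_def wide_rows_def last_step_def
          card_cells nat_add_distrib)
  next
    case False
    then obtain l where l: "k = 2 * l" by (auto elim: evenE)
    \<comment> \<open>The last bound is weaker by one than in the odd case; it suffices because the
      bottom row gains a cell.\<close>
    have lr: "1 \<le> l" "l \<le> run R" "int l \<le> snd (hd R) - fst (hd R)"
      using k l hd by (auto simp: last_step_def)
    have "l \<le> length R" using lr run_le_length[of R] by simp
    then show ?thesis
      using R l lr hd ne
      by (auto simp: step_def wide_rows_def last_step_def stanley_rows_extend_left
          card_cells_extend_left fst_hd_extend_left run_extend_left nat_diff_distrib)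
  qed
  then show "wide_rows (step k R)" and "last_step (step k R) = k"
    and "snd (last (step k R)) = snd (last R)"
    and "fst (hd (step k R)) = fst (hd R) - 1"
    and "card (cells (step k R)) + k div 2 = card (cells R) + 2 * ((k + 1) div 2)"
    by auto
qed

section \<open>Undoing a step\<close>

lemma inj_step: "step k R = step k R' \<Longrightarrow> R = R'"
  by (metis add_bottom_row_def list.inject shorten_extend step_def)

text \<open>The gap above the run is at least two, so it survives the shift, and a bottom row of
  three cells keeps the overlaps inside the run. The run may grow, since a gap of exactly two closes
  up.\<close>

lemma stanley_rows_shorten_left:
  assumes "stanley_rows R" "fst (hd R) + 2 \<le> snd (hd R)"
  shows "stanley_rows (shorten_left (run R) R) \<and> run R \<le> run (shorten_left (run R) R)"
  using assms
proof (induction R rule: run.induct)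
  case (3 x y R)
  show ?case
  proof (cases "fst y = fst x + 1")
    case True
    obtain m where m: "run (y # R) = Suc m"
      using run_pos[of "y # R"] by (metis Suc_le_D One_nat_def list.distinct(1))
    show ?thesis using "3.IH" "3.prems" True m by auto
  qed (use 3 in auto)
qed (auto simp: shorten_left_def)

text \<open>With \<open>w + 2\<close> cells in the bottom row, the last step was an extension if
  \<open>run R \<le> w\<close> and a new bottom row otherwise. The third column keeps the
  predecessor wide.\<close>

lemma step_surj:
  assumes R: "stanley_rows R" and col: "fst (hd R) + 1 < snd (last R)"
  obtains R' where "wide_rows R'" "R = step (last_step R) R'"
    "1 \<le> last_step R" "last_step R \<le> last_step R' + 1"
    "snd (last R') = snd (last R)" "fst (hd R') = fst (hd R) + 1"
proof -
  have ne: "R \<noteq> []" using R by auto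
  have wide: "wide_rows R" using R col by (simp add: wide_rows_def)
  have hd: "fst (hd R) < snd (hd R)" using wide_rows_hd[OF wide] .
  define w where "w = nat (snd (hd R) - fst (hd R) - 1)"
  have w: "int w = snd (hd R) - fst (hd R) - 1" using hd by (simp add: w_def)
  have ls: "last_step R = min (2 * run R) (2 * w + 1)" by (simp add: last_step_def w_def)
  have m: "run R \<ge> 1" using run_pos ne by simp
  show ?thesis
  proof (cases "run R \<le> w")
    case True
    let ?R' = "shorten_left (run R) R"
    have l: "last_step R = 2 * run R" using ls True by simp
    have eq: "R = extend_left (run R) ?R'" by simp
    have ne': "?R' \<noteq> []" using ne by (metis length_0_conv length_shorten_left)
    \<comment> \<open>The facts on \<open>extend_left\<close> are read backwards through
      \<open>eq\<close>.\<close>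
    have h: "fst (hd ?R') = fst (hd R) + 1"
      using fst_hd_extend_left[OF ne' m] by simp
    have h': "snd (hd ?R') = snd (hd R)"
      using snd_hd_extend_left[OF ne', of "run R"] by simp
    have la: "snd (last ?R') = snd (last R)"
      using snd_last_extend_left[of "run R" ?R'] by simp
    \<comment> \<open>From \<open>1 \<le> run R \<le> w\<close> the bottom row has at least three
      cells.\<close>
    have s: "stanley_rows ?R' \<and> run R \<le> run ?R'"
      using True m w by (intro stanley_rows_shorten_left[OF R]) auto
    show ?thesis
    proof (rule that[of ?R'])
      show "wide_rows ?R'" using s h la col by (simp add: wide_rows_def)
      show "R = step (last_step R) ?R'" by (simp add: l step_def)
      show "last_step R \<le> last_step ?R' + 1"
        using s True m h h' w unfolding l by (auto simp: last_step_def)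
    qed (use l m h la in auto)
  next
    case False
    have l: "last_step R = 2 * w + 1" using ls False by simp
    from ne obtain x T where xT: "R = x # T" by (cases R) auto
    \<comment> \<open>A single row has run 1, and three columns would give \<open>w \<ge> 1\<close>,
      against \<open>w < run R\<close>.\<close>
    have "T \<noteq> []"
    proof
      assume "T = []"
      then show False using False col w xT by auto
    qed
    then obtain y T' where T: "T = y # T'" by (cases T) auto
    have xy: "fst x < fst y" "fst y \<le> snd x" "snd x < snd y" "stanley_rows T"
      using R xT T by auto
    \<comment> \<open>A larger gap would make the run 1, while the overlap
      \<open>fst y \<le> snd x\<close> would force \<open>w \<ge> 1\<close>.\<close>
    have g: "fst y = fst x + 1"
    proof (rule ccontr)
      assume "\<not> ?thesis"
      then have "run R = 1" "w \<ge> 1" using xT T xy w by auto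
      then show False using False by simp
    qed
    have r: "run R = Suc (run T)" using xT T g by simp
    show ?thesis
    proof (rule that[of T])
      show "wide_rows T" using xy g col xT T by (auto simp: wide_rows_def)
      show "R = step (last_step R) T"
        using xT T g w unfolding l by (cases x) (simp add: step_def add_bottom_row_def)
      show "last_step R \<le> last_step T + 1"
        using r False xy g w xT T unfolding l by (auto simp: last_step_def)
    qed (use l xT T g in auto)
  qed
qed

section \<open>Diagonals of a coin fountain\<close>

definition add_diag :: "nat \<Rightarrow> coins \<Rightarrow> coins" where
  "add_diag k C = (\<lambda>j. (int j, j)) ` {..<k} \<union> (\<lambda>(a, j). (a + 2, j)) ` C"

lemma mem_add_diag:
  "(a, j) \<in> add_diag k C \<longleftrightarrow> a = int j \<and> j < k \<or> (a - 2, j) \<in> C"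
  by (force simp: add_diag_def)

lemma mem_delete_diag:
  "(a, j) \<in> delete_diag C \<longleftrightarrow> (a + 2, j) \<in> C \<and> a \<ge> int j"
  by (force simp: delete_diag_def)

lemma coin_fountain_row_0:
  "coin_fountain d C \<Longrightarrow> (a, 0) \<in> C \<longleftrightarrow> (\<exists>i. a = 2 * int i \<and> i < d)"
proof -
  assume C: "coin_fountain d C"
  have "(a, 0) \<in> C \<longleftrightarrow> (a, 0) \<in> {c \<in> C. snd c = 0}" by simp
  also have "\<dots> \<longleftrightarrow> (a, 0) \<in> {(2 * int i, 0 :: nat) | i. i \<le> d - 1}"
    using C unfolding coin_fountain_def by metis
  also have "\<dots> \<longleftrightarrow> (\<exists>i. a = 2 * int i \<and> i < d)"
    using C by (auto simp: coin_fountain_def)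
  finally show ?thesis .
qed

text \<open>The form with \<open>Suc j\<close> and \<open>i < d\<close> avoids truncated
  subtraction.\<close>

lemma coin_fountain_iff:
  "coin_fountain d C \<longleftrightarrow> d \<ge> 1 \<and> finite C \<and>
     (\<forall>a. (a, 0) \<in> C \<longleftrightarrow> (\<exists>i. a = 2 * int i \<and> i < d)) \<and>
     (\<forall>a j. (a, Suc j) \<in> C \<longrightarrow> (a - 1, j) \<in> C \<and> (a + 1, j) \<in> C)"
  (is "?L \<longleftrightarrow> ?R")
proof
  assume ?L
  then show ?R
    using coin_fountain_row_0[of d C] by (force simp: coin_fountain_def)
next
  assume R: ?R
  then have "{c \<in> C. snd c = 0} = {(2 * int i, 0) | i. i \<le> d - 1}"
    by force
  moreover have "(a - 1, j - 1) \<in> C \<and> (a + 1, j - 1) \<in> C" if "(a, j) \<in> C" "j \<ge> 1" for a j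
    using R that by (cases j) auto
  ultimately show ?L using R by (simp add: coin_fountain_def)
qed

text \<open>The fountain lies in the triangle over its bottom row: the lower left neighbour
  determines the diagonal and the lower right one gives the bound.\<close>

lemma coin_fountain_position:
  assumes "coin_fountain d C" "(a, j) \<in> C"
  shows "\<exists>i. a = 2 * int i + int j \<and> i + j < d"
  using assms(2)
proof (induction j arbitrary: a)
  case 0
  then show ?case using coin_fountain_row_0[OF assms(1)] by auto
next
  case (Suc j)
  then have "(a - 1, j) \<in> C" "(a + 1, j) \<in> C"
    using assms(1) by (auto simp: coin_fountain_iff)
  from this[THEN Suc.IH] obtain i i'
    where "a - 1 = 2 * int i + int j" "a + 1 = 2 * int i' + int j" "i' + j < d"
    by blast
  then show ?case by (intro exI[of _ i]) auto
qed

section \<open>Reading off, deleting and adding the first diagonal\<close>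

lemma finite_downset_nat:
  assumes "finite D" "\<And>j. Suc j \<in> D \<Longrightarrow> j \<in> D"
  shows "D = {..<card D}"
proof -
  have down: "i \<in> D" if "i \<le> j" "j \<in> D" for i j
    using that by (induction rule: inc_induct) (auto intro: assms(2))
  define m where "m = (LEAST j. j \<notin> D)"
  have "\<exists>j. j \<notin> D" using assms(1) ex_new_if_finite infinite_UNIV_nat by blast
  then have "m \<notin> D" unfolding m_def by (rule LeastI_ex)
  moreover have "j \<in> D" if "j < m" for j
    using not_less_Least that unfolding m_def by blast
  ultimately have "D = {..<m}"
    using down by (metis lessThan_iff linorder_not_less subsetI subset_antisym)
  then show ?thesis by simp
qed

text \<open>The lower left neighbour of a coin on the first diagonal is on it too, so the heights
  occurring there form an initial segment and \<open>diag C\<close> determines them.\<close>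

lemma mem_diag:
  assumes "coin_fountain d C"
  shows "(int j, j) \<in> C \<longleftrightarrow> j < diag C"
proof -
  let ?D = "{j. (int j, j) \<in> C}"
  have eq: "{c \<in> C. fst c = int (snd c)} = (\<lambda>j. (int j, j)) ` ?D" by force
  have "finite {c \<in> C. fst c = int (snd c)}" using assms by (simp add: coin_fountain_def)
  then have "finite ?D" unfolding eq by (rule finite_imageD) (auto simp: inj_on_def)
  moreover have "j \<in> ?D" if "Suc j \<in> ?D" for j
  proof -
    have "(int (Suc j) - 1, j) \<in> C" using that assms unfolding coin_fountain_iff by blast
    then show ?thesis by simp
  qed
  ultimately have "?D = {..<card ?D}" by (rule finite_downset_nat)
  moreover have "card ?D = diag C"
    unfolding diag_def eq by (simp add: card_image inj_on_def)
  ultimately show ?thesis by auto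
qed

lemma coin_fountain_1: "coin_fountain (Suc 0) C \<longleftrightarrow> C = {(0, 0)}"
proof
  assume C: "coin_fountain (Suc 0) C"
  have "c = (0, 0)" if "c \<in> C" for c
    using coin_fountain_position[OF C, of "fst c" "snd c"] that by (cases c) auto
  moreover have "(0, 0) \<in> C" using coin_fountain_row_0[OF C] by auto
  ultimately show "C = {(0, 0)}" by blast
qed (simp add: coin_fountain_iff)

lemma coin_fountain_delete_diag:
  assumes C: "coin_fountain (Suc (Suc d)) C"
  shows "coin_fountain (Suc d) (delete_diag C)"
    and "add_diag (diag C) (delete_diag C) = C"
    and "1 \<le> diag C" "diag C \<le> diag (delete_diag C) + 1"
proof -
  note row0 = coin_fountain_row_0[OF C] and pos = coin_fountain_position[OF C]
  have low: "(a - 1, j) \<in> C \<and> (a + 1, j) \<in> C" if "(a, Suc j) \<in> C" for a j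
    using C that unfolding coin_fountain_iff by blast
  show C': "coin_fountain (Suc d) (delete_diag C)"
    unfolding coin_fountain_iff
  proof (intro conjI allI impI)
    have "delete_diag C \<subseteq> (\<lambda>(a, j). (a - 2, j)) ` C" by (force simp: delete_diag_def)
    then show "finite (delete_diag C)"
      by (rule finite_subset) (use C in \<open>simp add: coin_fountain_def\<close>)
    show "(a, 0) \<in> delete_diag C \<longleftrightarrow> (\<exists>i. a = 2 * int i \<and> i < Suc d)" for a
    proof
      assume "(a, 0) \<in> delete_diag C"
      then obtain i where i: "a + 2 = 2 * int i" "i < Suc (Suc d)" "a \<ge> 0"
        by (auto simp: mem_delete_diag row0)
      then show "\<exists>i. a = 2 * int i \<and> i < Suc d" by (intro exI[of _ "i - 1"]) auto
    next
      assume "\<exists>i. a = 2 * int i \<and> i < Suc d"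
      then obtain i where "a = 2 * int i" "i < Suc d" by blast
      then show "(a, 0) \<in> delete_diag C"
        by (auto simp: mem_delete_diag row0 intro: exI[of _ "Suc i"])
    qed
    show "(a - 1, j) \<in> delete_diag C" "(a + 1, j) \<in> delete_diag C"
      if "(a, Suc j) \<in> delete_diag C" for a j
      using that low[of "a + 2" j] by (auto simp: mem_delete_diag algebra_simps)
  qed simp
  have "c \<in> add_diag (diag C) (delete_diag C) \<longleftrightarrow> c \<in> C" for c
  proof (cases c)
    case (Pair a j)
    show ?thesis
    proof (cases "a = int j")
      case True
      then show ?thesis using mem_diag[OF C, of j] Pair
        by (auto simp: mem_add_diag mem_delete_diag)
    next
      case False
      \<comment> \<open>By \<open>coin_fountain_position\<close>, \<open>a - j\<close> is even and
        nonnegative, so a nonzero value is at least 2.\<close>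
      have "a - 2 \<ge> int j" if "(a, j) \<in> C" using pos[OF that] False by auto
      then show ?thesis using Pair False by (auto simp: mem_add_diag mem_delete_diag)
    qed
  qed
  then show "add_diag (diag C) (delete_diag C) = C" by blast
  show "1 \<le> diag C" using mem_diag[OF C, of 0] row0[of 0] by auto
  show "diag C \<le> diag (delete_diag C) + 1"
  proof (rule ccontr)
    let ?j = "diag (delete_diag C)"
    assume "\<not> ?thesis"
    \<comment> \<open>This coin would rest on a coin of the second diagonal at height
      \<open>?j\<close>, one above the highest there.\<close>
    then have "(int (Suc ?j), Suc ?j) \<in> C" unfolding mem_diag[OF C] by simp
    from low[OF this] have "(int ?j, ?j) \<in> delete_diag C"
      by (auto simp: mem_delete_diag algebra_simps)
    then show False unfolding mem_diag[OF C'] by simp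
  qed
qed

text \<open>Conversely, \<open>k \<le> diag C + 1\<close> supplies the lower right neighbours of the
  new coins.\<close>

lemma coin_fountain_add_diag:
  assumes C: "coin_fountain d C" and k: "1 \<le> k" "k \<le> diag C + 1"
  shows "coin_fountain (Suc d) (add_diag k C)"
    and "diag (add_diag k C) = k" and "delete_diag (add_diag k C) = C"
proof -
  note row0 = coin_fountain_row_0[OF C] and pos = coin_fountain_position[OF C]
  have low: "(a - 1, j) \<in> C \<and> (a + 1, j) \<in> C" if "(a, Suc j) \<in> C" for a j
    using C that unfolding coin_fountain_iff by blast
  show C': "coin_fountain (Suc d) (add_diag k C)"
    unfolding coin_fountain_iff
  proof (intro conjI allI impI)
    show "finite (add_diag k C)" using C by (simp add: add_diag_def coin_fountain_def)
    show "(a, 0) \<in> add_diag k C \<longleftrightarrow> (\<exists>i. a = 2 * int i \<and> i < Suc d)" for a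
    proof
      assume "(a, 0) \<in> add_diag k C"
      then consider "a = 0" | i where "a - 2 = 2 * int i" "i < d"
        by (auto simp: mem_add_diag row0)
      then show "\<exists>i. a = 2 * int i \<and> i < Suc d"
      proof cases
        case 2
        then show ?thesis by (intro exI[of _ "Suc i"]) auto
      qed auto
    next
      assume "\<exists>i. a = 2 * int i \<and> i < Suc d"
      then obtain i where i: "a = 2 * int i" "i < Suc d" by blast
      then show "(a, 0) \<in> add_diag k C"
        using k by (cases i) (auto simp: mem_add_diag row0)
    qed
    fix a j assume *: "(a, Suc j) \<in> add_diag k C"
    show "(a - 1, j) \<in> add_diag k C"
      using * low[of "a - 2" j] by (auto simp: mem_add_diag algebra_simps)
    have "(int j, j) \<in> C" if "Suc j < k" using mem_diag[OF C, of j] that k by auto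
    then show "(a + 1, j) \<in> add_diag k C"
      using * low[of "a - 2" j] by (auto simp: mem_add_diag algebra_simps)
  qed simp
  \<comment> \<open>No shifted old coin lands on the new first diagonal.\<close>
  have no: "(int j - 2, j) \<notin> C" for j using pos[of "int j - 2" j] by auto
  have "j < diag (add_diag k C) \<longleftrightarrow> j < k" for j
    using mem_diag[OF C', of j] no by (auto simp: mem_add_diag)
  then show "diag (add_diag k C) = k" by (metis nat_neq_iff)
  have "(a, j) \<in> delete_diag (add_diag k C) \<longleftrightarrow> (a, j) \<in> C" for a j
    using pos[of a j] by (auto simp: mem_delete_diag mem_add_diag)
  then show "delete_diag (add_diag k C) = C" by auto
qed

lemma card_parity_lessThan:
  "card {j. j < k \<and> even j} = (k + 1) div 2" "card {j. j < k \<and> odd j} = k div 2"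
proof (induction k)
  case (Suc k)
  have "{j. j < Suc k \<and> P j} = (if P k then insert k {j. j < k \<and> P j} else {j. j < k \<and> P j})" for P
    by (auto simp: less_Suc_eq)
  then show "card {j. j < Suc k \<and> even j} = (Suc k + 1) div 2"
    "card {j. j < Suc k \<and> odd j} = Suc k div 2"
    using Suc by auto
qed auto

text \<open>The shift preserves heights and the new coins are disjoint from the old; a general
  \<open>P\<close> serves both parities.\<close>

lemma card_add_diag:
  assumes C: "coin_fountain d C"
  shows "card {c \<in> add_diag k C. P (snd c)} =
    card {c \<in> C. P (snd c)} + card {j. j < k \<and> P j}"
proof -
  let ?A = "(\<lambda>j. (int j, j)) ` {j. j < k \<and> P j}"
  let ?B = "(\<lambda>(a, j). (a + 2, j)) ` {c \<in> C. P (snd c)}"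
  have "{c \<in> add_diag k C. P (snd c)} = ?A \<union> ?B"
    by (force simp: add_diag_def)
  moreover have "?A \<inter> ?B = {}"
    using coin_fountain_position[OF C] by fastforce
  moreover have "finite ?A" "finite ?B" using C by (auto simp: coin_fountain_def)
  moreover have "card ?A = card {j. j < k \<and> P j}" by (simp add: card_image inj_on_def)
  moreover have "card ?B = card {c \<in> C. P (snd c)}"
    by (rule card_image) (auto simp: inj_on_def)
  ultimately show ?thesis by (simp add: card_Un_disjoint)
qed

text \<open>Every fountain arises from a single coin by adding diagonals. The index \<open>d\<close>
  is one less than the number of diagonals.\<close>

lemma fountain_induct [consumes 1, case_names single add]:
  assumes "coin_fountain (Suc d) C"
    and "P 0 {(0, 0)}"
    and "\<And>d k C. coin_fountain (Suc d) C \<Longrightarrow> 1 \<le> k \<Longrightarrow> k \<le> diag C + 1 \<Longrightarrow> P d C \<Longrightarrow>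
           P (Suc d) (add_diag k C)"
  shows "P d C"
  using assms(1)
proof (induction d arbitrary: C)
  case 0
  then show ?case using assms(2) by (simp add: coin_fountain_1)
next
  case (Suc d)
  note del = coin_fountain_delete_diag[OF Suc.prems]
  show ?case using assms(3)[OF del(1,3,4) Suc.IH[OF del(1)]] by (simp add: del(2))
qed

section \<open>The bijection\<close>

lemma fountain_rows_add_diag:
  assumes "coin_fountain (Suc d) C" "1 \<le> k" "k \<le> diag C + 1"
  shows "fountain_rows (Suc (Suc d)) (add_diag k C) = step k (fountain_rows (Suc d) C)"
  using coin_fountain_add_diag[OF assms] by (simp add: Let_def step_def)

text \<open>The equation \<open>last_step R = diag C\<close> carries the induction: it turns the
  bound on the next diagonal into the bound required by \<open>wide_rows_step\<close>. The right end
  of the top row never moves, and each step adds one column on the left.\<close>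

lemma fountain_rows_props:
  assumes "coin_fountain (Suc d) C"
  defines "R \<equiv> fountain_rows (Suc d) C"
  shows "wide_rows R \<and> last_step R = diag C \<and> snd (last R) = 1 \<and> fst (hd R) = - int d \<and>
    card (cells R) + odd_coins C = 2 * even_coins C"
  using assms(1) unfolding R_def
proof (induction rule: fountain_induct)
  case single
  have "diag {(0, 0)} = 1" "{c. c = (0 :: int, 0 :: nat) \<and> even (snd c)} = {(0, 0)}"
    by (auto simp: diag_def Collect_conv_if)
  moreover have "odd_coins {(0, 0)} = 0" by (auto simp: odd_coins_def)
  ultimately show ?case
    by (auto simp: wide_rows_def last_step_def card_cells even_coins_def)
next
  case (add d k C)
  let ?R = "fountain_rows (Suc d) C"
  have R: "wide_rows ?R" "last_step ?R = diag C" "snd (last ?R) = 1" "fst (hd ?R) = - int d"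
    "card (cells ?R) + odd_coins C = 2 * even_coins C"
    using add.IH by auto
  have "even_coins (add_diag k C) = even_coins C + (k + 1) div 2"
    "odd_coins (add_diag k C) = odd_coins C + k div 2"
    using card_add_diag[OF add.hyps(1), where P = even] card_add_diag[OF add.hyps(1), where P = odd]
    by (auto simp: even_coins_def odd_coins_def card_parity_lessThan)
  moreover note wide_rows_step[OF R(1), of k]
  ultimately show ?case
    unfolding fountain_rows_add_diag[OF add.hyps(1-3)]
    using R add.hyps coin_fountain_add_diag(2)[OF add.hyps(1-3)] by auto
qed

text \<open>Equal rows have equal \<open>last_step\<close>, hence equal first diagonals; cancelling
  that step leaves the fountains without them.\<close>

lemma fountain_rows_inj:
  assumes "coin_fountain (Suc d) C" "coin_fountain (Suc d) C'"
    and "fountain_rows (Suc d) C = fountain_rows (Suc d) C'"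
  shows "C = C'"
  using assms
proof (induction arbitrary: C' rule: fountain_induct)
  case single
  then show ?case by (simp add: coin_fountain_1)
next
  case (add d k C)
  note del = coin_fountain_delete_diag[OF add.prems(1)]
  note C = coin_fountain_add_diag[OF add.hyps(1-3)]
  have "diag (add_diag k C) = diag C'"
    using fountain_rows_props[OF C(1)] fountain_rows_props[OF add.prems(1)] add.prems(2) by metis
  then have k: "k = diag C'" using C(2) by simp
  have "step k (fountain_rows (Suc d) C) = step k (fountain_rows (Suc d) (delete_diag C'))"
    using add.prems(2) fountain_rows_add_diag[OF add.hyps(1-3)]
      fountain_rows_add_diag[OF del(1,3,4)] unfolding k del(2) by metis
  then have "C = delete_diag C'" using add.IH[OF del(1)] inj_step by blast
  then show ?case using del(2) k by simp
qed

lemma fountain_rows_surj: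
  assumes "stanley_rows R" "snd (last R) = 1" "fst (hd R) = - int d"
  shows "\<exists>C. coin_fountain (Suc d) C \<and> fountain_rows (Suc d) C = R"
  using assms
proof (induction d arbitrary: R)
  case 0
  have "R = [(0, 1)]"
  proof (cases R rule: run.cases)
    case (3 x y T)
    \<comment> \<open>Two columns allow at most two rows; the strict chain then rules out
      two.\<close>
    then have "length T = 0" using stanley_rows_columns[OF "0.prems"(1)] 0 by simp
    then show ?thesis using 0 3 by auto
  qed (use 0 in \<open>auto simp: prod_eq_iff\<close>)
  then show ?case using coin_fountain_1 by auto
next
  case (Suc d)
  have "fst (hd R) + 1 < snd (last R)" using Suc.prems by simp
  from step_surj[OF Suc.prems(1) this] obtain R' where R': "wide_rows R'"
    "R = step (last_step R) R'" "1 \<le> last_step R" "last_step R \<le> last_step R' + 1"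
    "snd (last R') = snd (last R)" "fst (hd R') = fst (hd R) + 1"
    by blast
  then have "\<exists>C. coin_fountain (Suc d) C \<and> fountain_rows (Suc d) C = R'"
    using Suc.prems by (intro Suc.IH) (auto simp: wide_rows_def)
  then obtain C where C: "coin_fountain (Suc d) C" "fountain_rows (Suc d) C = R'" by blast
  \<comment> \<open>Here \<open>last_step R'\<close> equals \<open>diag C\<close>, so a diagonal of
    \<open>last_step R\<close> coins may be added.\<close>
  then have le: "last_step R \<le> diag C + 1" using fountain_rows_props[OF C(1)] R'(4) by auto
  show ?case
    using coin_fountain_add_diag(1)[OF C(1) R'(3) le] fountain_rows_add_diag[OF C(1) R'(3) le]
      C(2) R'(2) by metis
qed

section \<open>Passing from rows to translation classes\<close>

lemma coin_fountain_Suc: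
  assumes "coin_fountain n C"
  obtains d where "n = Suc d"
  using assms by (cases n) (auto simp: coin_fountain_def)

lemma fountain_polyomino_eq:
  "coin_fountain n C \<Longrightarrow> fountain_polyomino C = translation_class (cells (fountain_rows n C))"
  by (simp add: fountain_polyomino_def num_diagonals_eq)

lemma fountain_polyomino_props:
  assumes "coin_fountain n C"
  shows "fountain_polyomino C \<in> stanley_polyominoes"
    and "num_columns (fountain_polyomino C) = int n + 1"
    and "area (fountain_polyomino C) + odd_coins C = 2 * even_coins C"
proof -
  obtain d where n: "n = Suc d" using assms by (rule coin_fountain_Suc)
  note R = fountain_rows_props[OF assms[unfolded n]]
  show "fountain_polyomino C \<in> stanley_polyominoes"
    "num_columns (fountain_polyomino C) = int n + 1"
    "area (fountain_polyomino C) + odd_coins C = 2 * even_coins C"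
    using R unfolding fountain_polyomino_eq[OF assms[unfolded n]]
    by (auto simp: wide_rows_def stanley_polyominoes_def num_columns_eq area_eq n)
qed

lemma inj_on_fountain_polyomino: "inj_on fountain_polyomino coin_fountains"
proof (rule inj_onI)
  fix C C' assume "C \<in> coin_fountains" "C' \<in> coin_fountains"
    and eq: "fountain_polyomino C = fountain_polyomino C'"
  then obtain n n' where nn: "coin_fountain n C" "coin_fountain n' C'"
    by (auto simp: coin_fountains_def)
  \<comment> \<open>The number of columns determines the number of diagonals.\<close>
  have "n = n'"
    using fountain_polyomino_props(2)[OF nn(1)] fountain_polyomino_props(2)[OF nn(2)] eq by simp
  moreover obtain d where "n = Suc d" using nn(1) by (rule coin_fountain_Suc)
  ultimately have C: "coin_fountain (Suc d) C" and C': "coin_fountain (Suc d) C'"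
    using nn by auto
  let ?R = "fountain_rows (Suc d) C" and ?R' = "fountain_rows (Suc d) C'"
  have R: "stanley_rows ?R" "snd (last ?R) = 1" and R': "stanley_rows ?R'" "snd (last ?R') = 1"
    using fountain_rows_props[OF C] fountain_rows_props[OF C'] by (auto simp: wide_rows_def)
  have "?R \<noteq> []" using R(1) by auto
  obtain u where u: "?R' = map (\<lambda>(s, e). (s + u, e + u)) ?R"
    using translation_class_cells_eqD[OF R(1) R'(1)] eq
    unfolding fountain_polyomino_eq[OF C] fountain_polyomino_eq[OF C'] by blast
  \<comment> \<open>Both top rows end at column 1, which leaves no room for a translation.\<close>
  have "u = 0"
    using R(2) R'(2) \<open>?R \<noteq> []\<close> unfolding u by (simp add: last_map case_prod_beta)
  then have "?R = ?R'" unfolding u by simp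
  then show "C = C'" using fountain_rows_inj[OF C C'] by simp
qed

lemma translation_class_translate: "translation_class (translate v X) = translation_class X"
proof -
  have tt: "translate u (translate w X) = translate (fst u + fst w, snd u + snd w) X" for u w X
    by (force simp: translate_def image_image case_prod_beta algebra_simps)
  have "translate u X = translate (fst u - fst v, snd u - snd v) (translate v X)" for u
    unfolding tt by simp
  then show ?thesis unfolding translation_class_def using tt by blast
qed

lemma cells_map_shift: "cells (map (\<lambda>(s, e). (s + u, e + u)) R) = translate (u, 0) (cells R)"
proof -
  have "(i, j) \<in> cells (map (\<lambda>(s, e). (s + u, e + u)) R) \<longleftrightarrow> (i - u, j) \<in> cells R" for i j
    by (auto simp: cells_def case_prod_beta)
  moreover have "(i, j) \<in> translate (u, 0) (cells R) \<longleftrightarrow> (i - u, j) \<in> cells R" for i j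
    by (force simp: translate_def)
  ultimately show ?thesis by auto
qed

lemma fountain_polyomino_surj:
  assumes "P \<in> stanley_polyominoes" "num_columns P \<ge> 2"
  shows "P \<in> fountain_polyomino ` coin_fountains"
proof -
  obtain R where R: "stanley_rows R" and P: "P = translation_class (cells R)"
    using assms(1) by (auto simp: stanley_polyominoes_def)
  have ne: "R \<noteq> []" using R by auto
  have col: "snd (last R) - fst (hd R) \<ge> 1"
    using assms(2) unfolding P num_columns_eq[OF R] by simp
  \<comment> \<open>The shift that brings the right end of the top row to 1; the bottom row then
    starts at \<open>- d\<close>.\<close>
  define u where "u = 1 - snd (last R)"
  define T where "T = map (\<lambda>(s, e). (s + u, e + u)) R"
  define d where "d = nat (snd (last R) - fst (hd R) - 1)"
  have "stanley_rows T"
    using R by (auto simp: T_def stanley_rows_def case_prod_beta)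
  moreover have "snd (last T) = 1" "fst (hd T) = - int d"
    using ne col by (simp_all add: T_def last_map hd_map case_prod_beta u_def d_def)
  ultimately obtain C where C: "coin_fountain (Suc d) C" "fountain_rows (Suc d) C = T"
    using fountain_rows_surj by blast
  have "fountain_polyomino C = P"
    unfolding fountain_polyomino_eq[OF C(1)] C(2) T_def cells_map_shift
      translation_class_translate P ..
  then show ?thesis using C(1) by (auto simp: coin_fountains_def)
qed

theorem theorem2p12:
  shows "bij_betw fountain_polyomino coin_fountains {P \<in> stanley_polyominoes. num_columns P \<ge> 2}
    \<and> (\<forall>n C. coin_fountain n C \<longrightarrow>
         num_columns (fountain_polyomino C) = int n + 1 \<and>
         2 * int (even_coins C) - int (odd_coins C) = int (area (fountain_polyomino C)))"
proof (intro conjI allI impI)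
  have "fountain_polyomino C \<in> {P \<in> stanley_polyominoes. num_columns P \<ge> 2}"
    if C: "C \<in> coin_fountains" for C
  proof -
    obtain n where n: "coin_fountain n C" using C by (auto simp: coin_fountains_def)
    then have "n \<ge> 1" by (simp add: coin_fountain_def)
    then show ?thesis using fountain_polyomino_props[OF n] by simp
  qed
  then show "bij_betw fountain_polyomino coin_fountains
      {P \<in> stanley_polyominoes. num_columns P \<ge> 2}"
    using inj_on_fountain_polyomino fountain_polyomino_surj by (auto simp: bij_betw_def)
  fix n C assume C: "coin_fountain n C"
  show "num_columns (fountain_polyomino C) = int n + 1"
    using fountain_polyomino_props(2)[OF C] .
  show "2 * int (even_coins C) - int (odd_coins C) = int (area (fountain_polyomino C))"
    using fountain_polyomino_props(3)[OF C] by linarith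
qed

end
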